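(* Let $a,b>0$ and $$\gamma=\frac{ab(a-b)+2ab\sqrt{a^2+ab+b^2}}{(a+b)^2}\in(0,a),$$ and let $\hat p_3$ be a real polynomial of degree $3$ for which there is a real polynomial $\hat q_1$ of degree $1$ with $$\hat p_3^2(s)-s\left(s-\frac1a\right)\left(s+\frac1b\right)\left(s-\frac1\gamma\right)\hat q_1^2(s)=1.$$ Then $\hat p_3$ can be expressed, up to a constant factor, through the Zolotarev polynomial $z_3$: $$\hat p_3(s)=\mathrm{const}\cdot z_3(2bs+1),$$ where $z_3$ is the Zolotarev polynomial of degree $3$ whose associated second interval is $[\alpha,\beta]$ with $\alpha=1+\frac{2b}{a}$, $\beta=1+\frac{2b}{\gamma}$.
   Context: Zolotarev polynomials: for a real parameter $\sigma$, among all real polynomials of the form $x^n-n\sigma x^{n-1}+p_2x^{n-2}+\dots+p_n$ consider the one with minimal uniform norm $L_n$ on $[-1,1]$. For $\sigma>\tan^2(\pi/2n)$ this minimizer, denoted $z_n$, is called the Zolotarev polynomial; there are $1<\alpha<\beta$ such that $|z_n|\le L_n$ on $[-1,1]\cup[\alpha,\beta]$ and $|z_n|>L_n$ elsewhere on $\mathbb{R}$, and the equation $z_n^2(x)=L_n^2$ has $n-2$ double solutions in $(-1,1)$ and simple solutions $-1,1,\alpha,\beta$. The interval $[\alpha,\beta]$ is called here the associated second interval of $z_n$. The value of $\gamma$ is the one in $(0,a)$ for which billiard trajectories within the ellipse $\frac{x^2}{a}+\frac{y^2}{b}=1$ in the Minkowski plane with caustic $\frac{x^2}{a-\gamma}+\frac{y^2}{b+\gamma}=1$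 are $3$-periodic. *)

theory Defs
  imports Complex_Main "HOL-Computational_Algebra.Polynomial"
begin

definition unif_norm :: "real poly \<Rightarrow> real" where
  "unif_norm p = (SUP x\<in>{-1..1}. \<bar>poly p x\<bar>)"

text \<open>The real polynomials \<open>x^n - n \<sigma> x^(n-1) + p\<^sub>2 x^(n-2) + \<dots> + p\<^sub>n\<close> (meaningful for \<open>n \<ge> 1\<close>).\<close>

definition zolotarev_class :: "nat \<Rightarrow> real \<Rightarrow> real poly set" where
  "zolotarev_class n \<sigma> =
     {p. degree p = n \<and> coeff p n = 1 \<and> coeff p (n - 1) = - (real n * \<sigma>)}"

definition zolotarev_poly :: "nat \<Rightarrow> real \<Rightarrow> real poly \<Rightarrow> bool" where
  "zolotarev_poly n \<sigma> z \<longleftrightarrow>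
     2 \<le> n \<and> \<sigma> > (tan (pi / (2 * real n)))\<^sup>2 \<and>
     is_arg_min unif_norm (\<lambda>p. p \<in> zolotarev_class n \<sigma>) z"

text \<open>
  The multiplicity of \<open>x\<close> as a solution of \<open>z^2 = L^2\<close> is its order as a root of the
  polynomial \<open>z^2 - L^2\<close>.  The listed multiplicities add up to the degree \<open>2n\<close> of this
  polynomial, so there are no further solutions.
\<close>

definition second_interval :: "nat \<Rightarrow> real poly \<Rightarrow> real \<Rightarrow> real \<Rightarrow> bool" where
  "second_interval n z \<alpha> \<beta> \<longleftrightarrow>
     (let L = unif_norm z; e = z\<^sup>2 - [:L\<^sup>2:] in
        1 < \<alpha> \<and> \<alpha> < \<beta> \<and>
        (\<forall>x \<in> {-1..1} \<union> {\<alpha>..\<beta>}. \<bar>poly z x\<bar> \<le> L) \<and>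
        (\<forall>x. x \<notin> {-1..1} \<union> {\<alpha>..\<beta>} \<longrightarrow> \<bar>poly z x\<bar> > L) \<and>
        card {x \<in> {-1<..<1}. order x e = 2} = n - 2 \<and>
        (\<forall>x \<in> {-1, 1, \<alpha>, \<beta>}. order x e = 1))"

definition zolotarev_with_second_interval ::
    "nat \<Rightarrow> real \<Rightarrow> real \<Rightarrow> real poly \<Rightarrow> bool" where
  "zolotarev_with_second_interval n \<alpha> \<beta> z \<longleftrightarrow>
     (\<exists>\<sigma>. zolotarev_poly n \<sigma> z) \<and> second_interval n z \<alpha> \<beta>"

end

theory Submission
  imports Defs
begin

text \<open>
  In the variable \<open>x = 2 b s + 1\<close> the Pell equation says that the monic cubic \<open>z\<close> proportional to
  \<open>p\<close> satisfies \<open>z\<^sup>2 - m\<^sup>2 = (x - r)\<^sup>2 (x\<^sup>2 - 1) (x - \<alpha>) (x - \<beta>)\<close>.  Since \<open>z\<close> is \<open>\<plusminus>m\<close> at \<open>r\<close> with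
  vanishing derivative, \<open>z = \<mu> + (x - r)\<^sup>2 (x - w)\<close> with \<open>\<mu> = \<plusminus>m\<close> and \<open>w\<close> one of \<open>1, -1, \<alpha>, \<beta>\<close>.
  The formula for \<open>\<gamma>\<close> enters only through \<open>\<beta> - \<alpha> < 2\<close>, which leaves \<open>w = \<beta>\<close> and determines \<open>z\<close>.
  As \<open>z\<close> takes the values \<open>-m, m, -m\<close> at \<open>-1 < r < 1\<close>, no cubic with the same two leading
  coefficients has smaller norm.  A Zolotarev cubic with second interval \<open>[\<alpha>, \<beta>]\<close> solves the same
  Pell equation, whence its uniqueness.
\<close>

text \<open>With r = (\<alpha> - \<beta>) / 2 and m = (\<alpha> + \<beta> r^2) / 2, this is the
  expansion of (x^2 - 1) (x - \<alpha>) - m. When (\<beta> - \<alpha>) (3 \<beta> + \<alpha>) = 4,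
  it also equals (x - r)^2 (x - \<beta>) + m.\<close>

definition zolotarev_cubic :: "real \<Rightarrow> real \<Rightarrow> real poly" where
  "zolotarev_cubic \<alpha> \<beta> = [:(\<alpha> - \<beta> * ((\<beta> - \<alpha>) / 2)\<^sup>2) / 2, -1, -\<alpha>, 1:]"

section \<open>Monic cubic solutions of the Pell equation\<close>

lemma cubic_poly_eq:
  fixes z :: "'a::zero poly"
  assumes "degree z = 3"
  shows "z = [:coeff z 0, coeff z 1, coeff z 2, coeff z 3:]"
proof (rule poly_eqI)
  fix n
  consider "n = 0" | "n = 1" | "n = 2" | "n = 3" | m where "n = Suc (Suc (Suc (Suc m)))"
    by (metis One_nat_def Suc_1 numeral_3_eq_3 not0_implies_Suc)
  then show "coeff z n = coeff [:coeff z 0, coeff z 1, coeff z 2, coeff z 3:] n"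
    using assms by cases (auto simp: numeral_2_eq_2 numeral_3_eq_3 intro: coeff_eq_0)
qed

lemma monic_cubic_pell_unique:
  fixes z :: "real poly"
  assumes deg: "degree z = 3" and monic: "coeff z 3 = 1"
    and \<alpha>: "1 < \<alpha>" and \<beta>: "\<alpha> < \<beta>" and gap: "\<beta> - \<alpha> < 2" and L: "L \<noteq> 0"
    and pell: "z\<^sup>2 - [:L\<^sup>2:] = [:-r, 1:]\<^sup>2 * ([:-1, 0, 1:] * [:-\<alpha>, 1:] * [:-\<beta>, 1:])"
  shows "z = zolotarev_cubic \<alpha> \<beta>" and "(\<beta> - \<alpha>) * (3 * \<beta> + \<alpha>) = 4"
proof -
  define A B C where "A = coeff z 2" and "B = coeff z 1" and "C = coeff z 0"
  have z: "z = [:C, B, A, 1:]"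
    using cubic_poly_eq[OF deg] monic by (simp add: A_def B_def C_def)
  define \<mu> w where "\<mu> = poly z r" and "w = - A - 2 * r"
  have "poly (z\<^sup>2 - [:L\<^sup>2:]) r = 0"
    unfolding pell by simp
  then have \<mu>2: "\<mu>\<^sup>2 = L\<^sup>2"
    by (simp add: \<mu>_def)
  have "poly (pderiv ([:-r, 1:]\<^sup>2 * g)) r = 0" for g
    by (simp only: pderiv_mult power2_eq_square poly_add poly_mult) simp
  then have "poly (pderiv (z\<^sup>2 - [:L\<^sup>2:])) r = 0"
    unfolding pell by blast
  moreover have "poly (pderiv (z\<^sup>2 - [:L\<^sup>2:])) r = 2 * \<mu> * poly (pderiv z) r"
    by (simp add: pderiv_diff pderiv_mult power2_eq_square pderiv_pCons \<mu>_def)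
  \<comment> \<open>The derivative of z^2 - L^2 at r is 2 \<mu> z'(r), and \<mu>^2 = L^2 is nonzero,
    so z itself is stationary at r.\<close>
  ultimately have "poly (pderiv z) r = 0"
    using \<mu>2 L by auto
  then have B: "B = r\<^sup>2 + 2 * r * w"
    by (simp add: z pderiv_pCons w_def algebra_simps power2_eq_square)
  have A: "A = - w - 2 * r"
    by (simp add: w_def)
  have C: "C = \<mu> - r\<^sup>2 * w"
    unfolding \<mu>_def z by (simp add: A B algebra_simps power2_eq_square)
  have zfac: "z = [:\<mu>:] + [:-r, 1:]\<^sup>2 * [:-w, 1:]"
    by (simp add: z A B C power2_eq_square algebra_simps)
  \<comment> \<open>Difference of squares: z - \<mu> = (x - r)^2 (x - w), and z + \<mu> exceeds it
    by 2 \<mu>. Cancelling (x - r)^2 then leaves an identity of quartics.\<close>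
  have "z\<^sup>2 - [:L\<^sup>2:] = [:-r, 1:]\<^sup>2 * ([:-w, 1:] * ([:-r, 1:]\<^sup>2 * [:-w, 1:] + [:2 * \<mu>:]))"
  proof -
    have "[:L\<^sup>2:] = [:\<mu>:]\<^sup>2" "[:2 * \<mu>:] = 2 * [:\<mu>:]"
      using \<mu>2 by (simp_all add: power2_eq_square numeral_poly)
    then show ?thesis
      unfolding zfac by algebra
  qed
  then have quartic: "[:-w, 1:] * ([:-r, 1:]\<^sup>2 * [:-w, 1:] + [:2 * \<mu>:])
      = [:-1, 0, 1:] * [:-\<alpha>, 1:] * [:-\<beta>, 1:]" (is "?lhs = ?rhs")
    unfolding pell by (subst (asm) mult_cancel_left) auto
  have "poly ?rhs w = 0"
    unfolding quartic[symmetric] by simp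
  then have w_cases: "w\<^sup>2 = 1 \<or> w = \<alpha> \<or> w = \<beta>"
    by (simp add: poly_mult power2_eq_square del: mult_pCons_left mult_pCons_right)
  from quartic have c3: "\<alpha> + \<beta> = 2 * (r + w)"
    and c2: "(r + w)\<^sup>2 + 2 * r * w = \<alpha> * \<beta> - 1"
    by (simp_all add: power2_eq_square algebra_simps)
  have c0: "r\<^sup>2 * w\<^sup>2 - 2 * \<mu> * w = - \<alpha> * \<beta>"
    using arg_cong[OF quartic, of "\<lambda>p. poly p 0"] by (simp add: power2_eq_square algebra_simps)
  have r: "r = (\<alpha> + \<beta>) / 2 - w"
    using c3 by (simp add: field_simps)
  \<comment> \<open>Eliminating r from the coefficients of x^3 and x^2 leaves a condition on w
    alone.\<close>
  have rel: "((\<beta> - \<alpha>) / 2)\<^sup>2 + 1 + w * (\<alpha> + \<beta>) - 2 * w\<^sup>2 = 0"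
    using c2 unfolding r by (simp add: power2_eq_square field_simps)
  have small: "((\<beta> - \<alpha>) / 2)\<^sup>2 < 1"
    using \<beta> gap by (simp add: power_less_one_iff abs_square_less_1)
  \<comment> \<open>With h = (\<beta> - \<alpha>) / 2, the values 1 and \<alpha> for w contradict
    \<open>rel\<close> by sign. The value -1 would give h^2 = 1 + \<alpha> + \<beta>, which
    \<open>small\<close> rules out.\<close>
  have w: "w = \<beta>"
    using w_cases
  proof (elim disjE)
    assume "w\<^sup>2 = 1"
    then have "w = 1 \<or> w = -1"
      by (simp add: power2_eq_1_iff)
    moreover have "((\<beta> - \<alpha>) / 2)\<^sup>2 \<ge> 0"
      by simp
    ultimately show ?thesis
      using rel small \<alpha> \<beta> by (elim disjE; simp)
  next
    assume "w = \<alpha>"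
    with rel have "((\<beta> - \<alpha>) / 2)\<^sup>2 + 1 + \<alpha> * (\<beta> - \<alpha>) = 0"
      by (simp add: power2_eq_square algebra_simps)
    moreover have "((\<beta> - \<alpha>) / 2)\<^sup>2 + 1 + \<alpha> * (\<beta> - \<alpha>) > 0"
      using \<alpha> \<beta> by (intro add_pos_pos add_nonneg_pos mult_pos_pos) auto
    ultimately show ?thesis
      by simp
  qed
  show "(\<beta> - \<alpha>) * (3 * \<beta> + \<alpha>) = 4"
    using rel unfolding w by (simp add: power2_eq_square field_simps)
  have r: "r = (\<alpha> - \<beta>) / 2"
    using r w by simp
  have "\<beta> * (2 * \<mu>) = \<beta> * (\<alpha> + r\<^sup>2 * \<beta>)"
    using c0 unfolding w by (simp add: power2_eq_square algebra_simps)
  then have \<mu>: "\<mu> = (\<alpha> + r\<^sup>2 * \<beta>) / 2"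
    using \<alpha> \<beta> by simp
  have "A = - \<alpha>" "C = (\<alpha> - \<beta> * ((\<beta> - \<alpha>) / 2)\<^sup>2) / 2"
    unfolding A C w \<mu> r by (simp_all add: power2_eq_square field_simps)
  moreover have "B = -1"
    using rel unfolding B w r by (simp add: power2_eq_square field_simps)
  ultimately show "z = zolotarev_cubic \<alpha> \<beta>"
    by (simp add: z zolotarev_cubic_def)
qed

section \<open>The uniform norm, and the Pell equation of a second interval\<close>

lemma abs_poly_le_unif_norm:
  assumes "\<bar>x\<bar> \<le> 1"
  shows "\<bar>poly p x\<bar> \<le> unif_norm p"
proof -
  obtain M where "\<forall>x. -1 \<le> x \<and> x \<le> 1 \<longrightarrow> \<bar>poly p x\<bar> \<le> M"
    using isCont_bounded[of "-1" 1 "\<lambda>x. \<bar>poly p x\<bar>"] by auto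
  then have "bdd_above ((\<lambda>x. \<bar>poly p x\<bar>) ` {-1..1})"
    by (intro bdd_aboveI[of _ M]) auto
  then show ?thesis
    unfolding unif_norm_def using assms by (intro cSUP_upper) auto
qed

lemma unif_norm_eqI:
  assumes "\<And>x. \<bar>x\<bar> \<le> 1 \<Longrightarrow> \<bar>poly p x\<bar> \<le> m" and "\<bar>x\<^sub>0\<bar> \<le> 1" and "\<bar>poly p x\<^sub>0\<bar> = m"
  shows "unif_norm p = m"
proof (rule antisym)
  show "unif_norm p \<le> m"
    unfolding unif_norm_def using assms(1) by (intro cSUP_least) auto
  show "m \<le> unif_norm p"
    using abs_poly_le_unif_norm[of x\<^sub>0 p] assms(2,3) by simp
qed

text \<open>One double root and four simple roots exhaust the degree 6 of the monic polynomial z^2 -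
  L^2. This brings any candidate Zolotarev cubic within reach of
  \<open>monic_cubic_pell_unique\<close>.\<close>

lemma second_interval_factorization:
  assumes deg: "degree z = 3" and monic: "coeff z 3 = 1"
    and "second_interval 3 z \<alpha> \<beta>"
  obtains r where "z\<^sup>2 - [:(unif_norm z)\<^sup>2:]
    = [:-r, 1:]\<^sup>2 * ([:-1, 0, 1:] * [:-\<alpha>, 1:] * [:-\<beta>, 1:])"
    and "unif_norm z \<noteq> 0"
proof -
  define L where "L = unif_norm z"
  define e where "e = z\<^sup>2 - [:L\<^sup>2:]"
  have \<alpha>: "1 < \<alpha>" "\<alpha> < \<beta>"
    and card: "card {x \<in> {-1<..<1}. order x e = 2} = 1"
    and ord: "order (-1) e = 1" "order 1 e = 1" "order \<alpha> e = 1" "order \<beta> e = 1"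
    using assms(3) by (simp_all add: second_interval_def Let_def L_def e_def)
  obtain r where "{x \<in> {-1<..<1}. order x e = 2} = {r}"
    using card by (auto simp: card_1_singleton_iff)
  then have r: "-1 < r" "r < 1" "order r e = 2"
    by auto
  define A B C where "A = coeff z 2" and "B = coeff z 1" and "C = coeff z 0"
  have z: "z = [:C, B, A, 1:]"
    using cubic_poly_eq[OF deg] monic by (simp add: A_def B_def C_def)
  have e6: "degree e = 6" "lead_coeff e = 1"
    by (simp_all add: e_def z power2_eq_square)
  then have "e \<noteq> 0"
    by auto
  from order_1[of r e] obtain f where f: "e = [:-r, 1:]\<^sup>2 * f"
    unfolding r(3) by (auto elim: dvdE)
  have "f \<noteq> 0"
    using \<open>e \<noteq> 0\<close> f by auto
  have "degree f = 4"
    using e6(1) \<open>f \<noteq> 0\<close> unfolding f by (simp add: degree_mult_eq degree_power_eq)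
  have "lead_coeff f = 1"
    using e6(2) unfolding f by (simp add: lead_coeff_mult lead_coeff_power)
  have root: "poly f x = 0" if "order x e = 1" "x \<noteq> r" for x
  proof -
    have "poly e x = 0"
      using that \<open>e \<noteq> 0\<close> by (simp add: order_root)
    then show ?thesis
      using that(2) by (simp add: f)
  qed
  \<comment> \<open>Two monic quartics that agree at four distinct points are equal.\<close>
  have "f = [:-1, 0, 1:] * [:-\<alpha>, 1:] * [:-\<beta>, 1:]"
  proof (rule poly_eqI_degree_lead_coeff[where n = 4 and A = "{-1, 1, \<alpha>, \<beta>}"])
    show "coeff f 4 = coeff ([:-1, 0, 1:] * [:-\<alpha>, 1:] * [:-\<beta>, 1:]) 4"
      using \<open>degree f = 4\<close> \<open>lead_coeff f = 1\<close> by (simp add: numeral_eq_Suc)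
    show "poly f x = poly ([:-1, 0, 1:] * [:-\<alpha>, 1:] * [:-\<beta>, 1:]) x"
      if "x \<in> {-1, 1, \<alpha>, \<beta>}" for x
      using that root ord \<alpha> r by auto
  qed (use \<alpha> \<open>degree f = 4\<close> in auto)
  with f have e: "e = [:-r, 1:]\<^sup>2 * ([:-1, 0, 1:] * [:-\<alpha>, 1:] * [:-\<beta>, 1:])"
    by simp
  moreover have "L \<noteq> 0"
  proof
    \<comment> \<open>Then \<open>e\<close> would be the square of z, yet its factorization is
      negative strictly between r and 1.\<close>
    assume "L = 0"
    define x where "x = (r + 1) / 2"
    have x: "-1 < x" "x < 1" "x \<noteq> r"
      using r by (auto simp: x_def)
    have "poly e x = (x - r)\<^sup>2 * ((1 - x) * (1 + x) * (\<alpha> - x) * (x - \<beta>))"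
      unfolding e by (simp add: algebra_simps)
    moreover have "(x - r)\<^sup>2 * ((1 - x) * (1 + x) * (\<alpha> - x) * (x - \<beta>)) < 0"
      using x \<alpha> by (intro mult_pos_neg mult_pos_pos) auto
    moreover have "poly e x \<ge> 0"
      by (simp add: e_def \<open>L = 0\<close>)
    ultimately show False
      by simp
  qed
  ultimately show ?thesis
    using that unfolding e_def L_def by blast
qed

section \<open>The explicit cubic is a Zolotarev polynomial\<close>

context
  fixes \<alpha> \<beta> :: real
  assumes \<alpha>: "1 < \<alpha>" and \<beta>: "\<alpha> < \<beta>" and rel: "(\<beta> - \<alpha>) * (3 * \<beta> + \<alpha>) = 4"
begin

text \<open>The double point and the norm, with the values forced on them in
  \<open>monic_cubic_pell_unique\<close>.\<close>

private definition "r = (\<alpha> - \<beta>) / 2"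
private definition "m = (\<alpha> + \<beta> * r\<^sup>2) / 2"

text \<open>Since 3 \<beta> + \<alpha> > 4, the relation forces \<beta> - \<alpha> < 1.\<close>

private lemma r_bounds: "-1 < r" "r < 0"
proof -
  have "(\<beta> - \<alpha>) * 4 < (\<beta> - \<alpha>) * (3 * \<beta> + \<alpha>)"
    using \<alpha> \<beta> by (intro mult_strict_left_mono) auto
  then show "-1 < r" "r < 0"
    using rel \<beta> by (auto simp: r_def)
qed

private lemma m_pos: "m > 0"
  unfolding m_def using \<alpha> \<beta> by (intro divide_pos_pos add_pos_nonneg) auto

text \<open>The relation enters through the coefficient of x. The signs of this product for z - m
  and of the next one for z + m decide where z stays within m in absolute value.\<close>

private lemma zolotarev_cubic_upper:
  "zolotarev_cubic \<alpha> \<beta> = [:m:] + [:-r, 1:]\<^sup>2 * [:-\<beta>, 1:]"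
proof -
  have "r\<^sup>2 + 2 * r * \<beta> = -1"
    using rel by (simp add: r_def power2_eq_square field_simps)
  then show ?thesis
    by (simp add: zolotarev_cubic_def m_def r_def power2_eq_square field_simps)
qed

private lemma zolotarev_cubic_lower:
  "zolotarev_cubic \<alpha> \<beta> = - [:m:] + [:-1, 0, 1:] * [:-\<alpha>, 1:]"
  by (simp add: zolotarev_cubic_def m_def r_def power2_eq_square field_simps)

private lemma poly_upper: "poly (zolotarev_cubic \<alpha> \<beta>) x = m + (x - r)\<^sup>2 * (x - \<beta>)"
  unfolding zolotarev_cubic_upper by (simp add: algebra_simps)

private lemma poly_lower: "poly (zolotarev_cubic \<alpha> \<beta>) x = - m + (x - 1) * (x + 1) * (x - \<alpha>)"
  unfolding zolotarev_cubic_lower by (simp add: algebra_simps)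

private lemma abs_le:
  assumes "x \<in> {-1..1} \<union> {\<alpha>..\<beta>}"
  shows "\<bar>poly (zolotarev_cubic \<alpha> \<beta>) x\<bar> \<le> m"
proof -
  have "(x - r)\<^sup>2 * (x - \<beta>) \<le> 0"
    using assms \<alpha> \<beta> by (intro mult_nonneg_nonpos) auto
  moreover have "(x - 1) * (x + 1) * (x - \<alpha>) \<ge> 0"
    using assms
  proof
    assume "x \<in> {-1..1}"
    then show ?thesis
      using \<alpha> by (intro mult_nonpos_nonpos mult_nonpos_nonneg) auto
  next
    assume "x \<in> {\<alpha>..\<beta>}"
    then show ?thesis
      using \<alpha> by (intro mult_nonneg_nonneg) auto
  qed
  ultimately show ?thesis
    using poly_upper[of x] poly_lower[of x] by auto
qed

private lemma abs_gt:
  assumes "x \<notin> {-1..1} \<union> {\<alpha>..\<beta>}"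
  shows "\<bar>poly (zolotarev_cubic \<alpha> \<beta>) x\<bar> > m"
proof -
  consider "x < -1" | "1 < x" "x < \<alpha>" | "\<beta> < x"
    using assms by force
  then show ?thesis
  proof cases
    case 1
    then have "(x - 1) * (x + 1) * (x - \<alpha>) < 0"
      using \<alpha> by (intro mult_pos_neg mult_neg_neg) auto
    then show ?thesis
      using poly_lower[of x] by auto
  next
    case 2
    then have "(x - 1) * (x + 1) * (x - \<alpha>) < 0"
      by (intro mult_pos_neg mult_pos_pos) auto
    then show ?thesis
      using poly_lower[of x] by auto
  next
    case 3
    then have "(x - r)\<^sup>2 * (x - \<beta>) > 0"
      using \<alpha> \<beta> r_bounds by (intro mult_pos_pos) auto
    then show ?thesis
      using poly_upper[of x] by auto
  qed
qed

private lemma unif_norm_cubic: "unif_norm (zolotarev_cubic \<alpha> \<beta>) = m"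
proof (rule unif_norm_eqI[where x\<^sub>0 = 1])
  show "\<bar>poly (zolotarev_cubic \<alpha> \<beta>) 1\<bar> = m"
    using poly_lower[of 1] m_pos by simp
qed (auto intro!: abs_le)

lemma second_interval_zolotarev_cubic: "second_interval 3 (zolotarev_cubic \<alpha> \<beta>) \<alpha> \<beta>"
proof -
  let ?z = "zolotarev_cubic \<alpha> \<beta>"
  let ?e = "?z\<^sup>2 - [:m\<^sup>2:]"
  \<comment> \<open>The form -(-1) gives every linear factor the shape that \<open>lin\<close>
    expects.\<close>
  have e: "?e = [:-r, 1:]\<^sup>2 * ([:-1, 1:] * [:-(-1), 1:] * [:-\<alpha>, 1:] * [:-\<beta>, 1:])"
  proof -
    have "?e = (?z - [:m:]) * (?z + [:m:])"
      by (simp add: power2_eq_square algebra_simps)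
    also have "?z - [:m:] = [:-r, 1:]\<^sup>2 * [:-\<beta>, 1:]"
      unfolding zolotarev_cubic_upper by simp
    also have "?z + [:m:] = [:-1, 1:] * [:-(-1), 1:] * [:-\<alpha>, 1:]"
      unfolding zolotarev_cubic_lower by simp
    finally show ?thesis
      by (simp only: mult_ac)
  qed
  have lin: "order x [:-c, 1:] = (if x = c then 1 else 0)" for x c :: real
    using order_power_n_n[of c 1] by (auto intro: order_0I)
  have sq: "order x ([:-r, 1:]\<^sup>2) = (if x = r then 2 else 0)" for x
    using order_power_n_n[of r 2] by (auto intro: order_0I)
  have ord: "order x ?e = (if x = r then 2 else 0) + ((if x = 1 then 1 else 0)
      + (if x = -1 then 1 else 0) + (if x = \<alpha> then 1 else 0) + (if x = \<beta> then 1 else 0))" for x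
    unfolding e by (subst order_mult, simp del: mult_pCons_left mult_pCons_right)+
      (simp only: lin sq)
  have "{x \<in> {-1<..<1}. order x ?e = 2} = {r}"
    using r_bounds \<alpha> \<beta> by (auto simp: ord split: if_splits)
  then show ?thesis
    using \<alpha> \<beta> r_bounds abs_le abs_gt
    by (simp add: second_interval_def Let_def unif_norm_cubic ord)
qed

text \<open>A competitor differs from the cubic by an affine function. If its norm were smaller,
  that function would be negative at -1 and 1 but positive at r between them.\<close>

lemma zolotarev_poly_zolotarev_cubic: "zolotarev_poly 3 (\<alpha> / 3) (zolotarev_cubic \<alpha> \<beta>)"
  unfolding zolotarev_poly_def is_arg_min_def
proof (intro conjI notI)
  \<comment> \<open>The squared tangent of pi / 6 is 1 / 3, so the bound on \<sigma> is exactly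
    \<alpha> > 1.\<close>
  show "(tan (pi / (2 * real 3)))\<^sup>2 < \<alpha> / 3"
    using \<alpha> by (simp add: tan_30 power_divide)
  show "zolotarev_cubic \<alpha> \<beta> \<in> zolotarev_class 3 (\<alpha> / 3)"
    by (simp add: zolotarev_class_def zolotarev_cubic_def numeral_eq_Suc)
  assume "\<exists>p. p \<in> zolotarev_class 3 (\<alpha> / 3) \<and> unif_norm p < unif_norm (zolotarev_cubic \<alpha> \<beta>)"
  then obtain p where p: "degree p = 3" "coeff p 3 = 1" "coeff p 2 = - \<alpha>"
    and less: "unif_norm p < m"
    by (auto simp: zolotarev_class_def unif_norm_cubic)
  obtain B C where pBC: "p = [:C, B, -\<alpha>, 1:]"
    using cubic_poly_eq[OF p(1)] p by metis
  obtain u v where d: "poly (zolotarev_cubic \<alpha> \<beta>) x - poly p x = u + v * x" for x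
    by (rule that[of "(\<alpha> - \<beta> * ((\<beta> - \<alpha>) / 2)\<^sup>2) / 2 - C" "-1 - B"])
      (simp add: pBC zolotarev_cubic_def algebra_simps)
  have bound: "\<bar>poly p x\<bar> < m" if "\<bar>x\<bar> \<le> 1" for x
    using abs_poly_le_unif_norm[OF that, of p] less by simp
  have "u - v < 0" "u + v < 0"
    using d[of "-1"] d[of 1] poly_lower[of "-1"] poly_lower[of 1] bound[of "-1"] bound[of 1]
    by auto
  moreover have "u + v * r > 0"
    using d[of r] poly_upper[of r] bound[of r] r_bounds by auto
  \<comment> \<open>The value at r is the convex combination of the endpoint values with weights (1
    + r) / 2 and (1 - r) / 2.\<close>
  moreover have "u + v * r = ((u + v) * (1 + r) + (u - v) * (1 - r)) / 2"
    by (simp add: algebra_simps)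
  moreover have "(u + v) * (1 + r) < 0" "(u - v) * (1 - r) < 0"
    using calculation r_bounds by (auto intro: mult_neg_pos)
  ultimately show False
    by simp
qed simp

end

text \<open>Uniqueness comes from the second interval, through the Pell equation, and not from
  comparing minimizers.\<close>

lemma zolotarev_with_second_interval_cubic_iff:
  assumes "1 < \<alpha>" "\<alpha> < \<beta>" "\<beta> - \<alpha> < 2" "(\<beta> - \<alpha>) * (3 * \<beta> + \<alpha>) = 4"
  shows "zolotarev_with_second_interval 3 \<alpha> \<beta> z \<longleftrightarrow> z = zolotarev_cubic \<alpha> \<beta>"
proof
  assume "zolotarev_with_second_interval 3 \<alpha> \<beta> z"
  then have z: "degree z = 3" "coeff z 3 = 1" and si: "second_interval 3 z \<alpha> \<beta>"
    by (auto simp: zolotarev_with_second_interval_def zolotarev_poly_def zolotarev_class_def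
        is_arg_min_def)
  show "z = zolotarev_cubic \<alpha> \<beta>"
    using second_interval_factorization[OF z si] monic_cubic_pell_unique(1)[OF z assms(1-3)]
    by metis
qed (use assms second_interval_zolotarev_cubic zolotarev_poly_zolotarev_cubic in
    \<open>unfold zolotarev_with_second_interval_def, blast\<close>)

section \<open>Bounds on the caustic parameter, and the change of variable\<close>

lemma caustic_parameter_bounds:
  fixes a b \<gamma> :: real
  assumes "a > 0" and "b > 0"
    and \<gamma>: "\<gamma> = (a * b * (a - b) + 2 * a * b * sqrt (a\<^sup>2 + a * b + b\<^sup>2)) / (a + b)\<^sup>2"
  shows "a * b / (a + b) < \<gamma>" and "\<gamma> < a"
proof -
  define D where "D = sqrt (a\<^sup>2 + a * b + b\<^sup>2)"
  have \<gamma>: "\<gamma> = a * b * (a - b + 2 * D) / (a + b)\<^sup>2"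
    unfolding \<gamma> D_def by (simp add: algebra_simps)
  \<comment> \<open>This makes a - b + 2 D exceed a + b, which is the lower bound on
    \<gamma>.\<close>
  have "D > b"
    unfolding D_def using assms by (intro real_less_rsqrt) (simp add: add_pos_pos)
  have "a * b / (a + b) = a * b * (a + b) / (a + b)\<^sup>2"
    using assms by (simp add: power2_eq_square)
  also have "\<dots> < \<gamma>"
    unfolding \<gamma> using assms \<open>D > b\<close> by (intro divide_strict_right_mono mult_strict_left_mono) auto
  finally show "a * b / (a + b) < \<gamma>" .
  \<comment> \<open>The number squared on the right is the value of D at which \<gamma> would equal
    a.\<close>
  have "a\<^sup>2 + a * b + b\<^sup>2 < (b + a * (a + b) / (2 * b))\<^sup>2"
  proof -
    have "(b + a * (a + b) / (2 * b))\<^sup>2 = a\<^sup>2 + a * b + b\<^sup>2 + (a * (a + b) / (2 * b))\<^sup>2"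
      using assms by (simp add: power2_eq_square field_simps)
    moreover have "(a * (a + b) / (2 * b))\<^sup>2 > 0"
      using assms by simp
    ultimately show ?thesis
      by simp
  qed
  then have "D < b + a * (a + b) / (2 * b)"
    unfolding D_def using assms by (intro real_less_lsqrt) auto
  then have "b * (a - b + 2 * D) < (a + b)\<^sup>2"
    using assms by (simp add: field_simps power2_eq_square)
  then show "\<gamma> < a"
    unfolding \<gamma> using assms by (simp add: divide_less_eq mult.assoc)
qed

theorem proposition8p4:
  fixes a b \<gamma> :: real and p q :: "real poly"
  assumes "a > 0" and "b > 0"
    and "\<gamma> = (a * b * (a - b) + 2 * a * b * sqrt (a\<^sup>2 + a * b + b\<^sup>2)) / (a + b)\<^sup>2"
    and "degree p = 3" and "degree q = 1"
    and "\<And>s. (poly p s)\<^sup>2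
           - s * (s - 1 / a) * (s + 1 / b) * (s - 1 / \<gamma>) * (poly q s)\<^sup>2 = 1"
  shows "0 < \<gamma> \<and> \<gamma> < a \<and>
    (\<exists>z. (\<forall>y. zolotarev_with_second_interval 3 (1 + 2 * b / a) (1 + 2 * b / \<gamma>) y \<longleftrightarrow> y = z) \<and>
         (\<exists>c. c \<noteq> 0 \<and> (\<forall>s. poly p s = c * poly z (2 * b * s + 1))))"
proof -
  note a = assms(1) and b = assms(2) and pell = assms(6)
  note \<gamma>_lower = caustic_parameter_bounds(1)[OF assms(1-3)]
    and \<gamma>_less = caustic_parameter_bounds(2)[OF assms(1-3)]
  have "0 < a * b / (a + b)"
    using a b by simp
  with \<gamma>_lower have \<gamma>_pos: "0 < \<gamma>"
    by simp
  define \<alpha> \<beta> where "\<alpha> = 1 + 2 * b / a" and "\<beta> = 1 + 2 * b / \<gamma>"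
  have \<alpha>: "1 < \<alpha>" and \<beta>: "\<alpha> < \<beta>"
    using a b \<gamma>_pos \<gamma>_less by (simp_all add: \<alpha>_def \<beta>_def divide_strict_left_mono)
  \<comment> \<open>This is equivalent to the lower bound a b / (a + b) < \<gamma>.\<close>
  have gap: "\<beta> - \<alpha> < 2"
    using \<gamma>_lower a b \<gamma>_pos by (simp add: \<alpha>_def \<beta>_def field_simps)
  \<comment> \<open>The inverse of the substitution x = 2 b s + 1.\<close>
  define l where "l = [:- (1 / (2 * b)), 1 / (2 * b):]"
  define P where "P = p \<circ>\<^sub>p l"
  define c where "c = lead_coeff P"
  define z where "z = smult (1 / c) P"
  have l: "degree l = 1"
    using b by (simp add: l_def)
  have P: "degree P = 3"
    by (simp add: P_def degree_pcompose l assms(4))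
  then have c: "c \<noteq> 0"
    by (metis c_def degree_0 leading_coeff_0_iff zero_neq_numeral)
  have z3: "degree z = 3" "coeff z 3 = 1"
    using c P by (simp_all add: z_def c_def)
  obtain q\<^sub>0 q\<^sub>1 where q: "q = [:q\<^sub>0, q\<^sub>1:]" "q\<^sub>1 \<noteq> 0"
    using assms(5) by (cases q) (auto split: if_splits elim!: degree_eq_zeroE)
  \<comment> \<open>\<open>r\<close> is the image of the root of q under x = 2 b s + 1;
    \<open>k\<close> collects the constants from rescaling and turns out to be 1, since both sides
    are monic.\<close>
  define r k where "r = 1 - 2 * b * q\<^sub>0 / q\<^sub>1" and "k = (q\<^sub>1 / (c * (2 * b) ^ 3))\<^sup>2"
  let ?D = "[:-r, 1:]\<^sup>2 * ([:-1, 0, 1:] * [:-\<alpha>, 1:] * [:-\<beta>, 1:])"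
  have "poly (z\<^sup>2 - [:(1 / c)\<^sup>2:]) x = poly (smult k ?D) x" for x
  proof -
    define s where "s = (x - 1) / (2 * b)"
    have x: "x = 2 * b * s + 1"
      using b by (simp add: s_def)
    have Px: "poly P x = poly p s"
      by (simp add: P_def poly_pcompose l_def s_def diff_divide_distrib)
    have D: "poly ?D x = (2 * b) ^ 6 * (s * (s - 1 / a) * (s + 1 / b) * (s - 1 / \<gamma>))
        * (poly q s / q\<^sub>1)\<^sup>2"
    proof -
      have "x - r = 2 * b * (poly q s / q\<^sub>1)" "x - \<alpha> = 2 * b * (s - 1 / a)"
        "x - \<beta> = 2 * b * (s - 1 / \<gamma>)" "x - 1 = 2 * b * s" "x + 1 = 2 * b * (s + 1 / b)"
        using a b q \<gamma>_pos by (simp_all add: x r_def \<alpha>_def \<beta>_def field_simps)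
      moreover have "poly ?D x = (x - r)\<^sup>2 * ((x - 1) * (x + 1) * (x - \<alpha>) * (x - \<beta>))"
        by (simp add: algebra_simps)
      ultimately show ?thesis
        by (simp add: power_mult_distrib power2_eq_square eval_nat_numeral)
    qed
    have "poly (smult k ?D) x = s * (s - 1 / a) * (s + 1 / b) * (s - 1 / \<gamma>) * (poly q s)\<^sup>2 / c\<^sup>2"
      unfolding poly_smult D k_def using q c b
      by (simp add: power_divide power_mult_distrib flip: power_mult)
    also have "\<dots> = ((poly p s)\<^sup>2 - 1) / c\<^sup>2"
      using pell[of s] by (simp add: algebra_simps)
    also have "\<dots> = poly (z\<^sup>2 - [:(1 / c)\<^sup>2:]) x"
      by (simp add: z_def Px power_divide diff_divide_distrib)
    finally show ?thesis
      by simp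
  qed
  then have e: "z\<^sup>2 - [:(1 / c)\<^sup>2:] = smult k ?D"
    by (intro poly_ext)
  moreover have "k = 1"
  proof -
    have "coeff (z\<^sup>2 - [:(1 / c)\<^sup>2:]) 6 = 1"
      using coeff_mult_degree_sum[of z z] z3 by (simp add: power2_eq_square numeral_eq_Suc)
    moreover have "coeff ?D 6 = 1"
      by (simp add: power2_eq_square numeral_eq_Suc)
    ultimately show ?thesis
      using e by simp
  qed
  ultimately have "z\<^sup>2 - [:(1 / c)\<^sup>2:] = ?D"
    by (simp only: smult_1_left)
  \<comment> \<open>The relation between \<alpha> and \<beta> comes out of the Pell equation instead
    of a computation with the formula for \<gamma>.\<close>
  then have z: "z = zolotarev_cubic \<alpha> \<beta>" and rel: "(\<beta> - \<alpha>) * (3 * \<beta> + \<alpha>) = 4"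
    using monic_cubic_pell_unique[OF z3 \<alpha> \<beta> gap, of "1 / c" r] c
    by (metis divide_eq_0_iff zero_neq_one)+
  have "poly p s = c * poly z (2 * b * s + 1)" for s
    using b c by (simp add: z_def P_def poly_pcompose l_def field_simps)
  with c zolotarev_with_second_interval_cubic_iff[OF \<alpha> \<beta> gap rel] \<gamma>_pos \<gamma>_less show ?thesis
    unfolding \<alpha>_def \<beta>_def z by blast
qed

end
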